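(* Assume (H1)--(H5). For $R>0$ and $1\le i,j\le d$ let $T_R,V_{ij,R}$ solve \[ \begin{cases}-A:D^2T_R=1&\text{in }B_R,\\ T_R=0&\text{on }\partial B_R,\end{cases} \qquad \begin{cases}-A:D^2V_{ij,R}=A_{ij}&\text{in }B_R,\\ V_{ij,R}=0&\text{on }\partial B_R,\end{cases} \] and define $\widehat A_{R,ij}=V_{ij,R}(0)/T_R(0)$. Set $\kappa_R=\min_{\overline{B_R}}\lambda_{\min}(A)>0$. Then $\widehat A_R$ is well defined, symmetric and measurable, with \[ \kappa_RI\le\widehat A_R\le I. \] Moreover, for $X_R=R^{-2}\sup_{|M|\le1}\|w_{M,R}\|_{L^\infty(B_R)}$, where $w_{M,R}$ solves $-A:D^2w_{M,R}=(A-\bar A):M$ in $B_R$ with $w_{M,R}=0$ on $\partial B_R$, \[ |\widehat A_R-\bar A|\le2dX_R. \]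
   Context: Setting. $d\ge2$; $\mathbb S^d$ is the space of real symmetric $d\times d$ matrices with Frobenius norm $|\cdot|$ and pairing $M:N=\operatorname{tr}(M^{\mathsf T}N)$; $M$ ranges over $\mathbb S^d$; $B_R$ is the open ball of radius $R$ about $0$. The probability space is the canonical space of continuous matrix fields $A=A(x,\omega)$ on $\mathbb R^d$, with the locally uniform topology and its Borel $\sigma$-algebra; translations $\tau_z$ satisfy $A(x,\tau_z\omega)=A(x+z,\omega)$; the law is $\mathbb P$ with expectation $\mathbb E$. Assumptions: (H1) Almost surely, for every $x$, $A(x)=A(x)^{\mathsf T}$ and $0<A(x)\le I$. (H2) Every $\tau_z$ preserves $\mathbb P$. (H3) There is $\ell<\infty$ such that $\sigma(A|_U)$ and $\sigma(A|_V)$ are independent whenever $U,V$ are deterministic Borel sets with $\operatorname{dist}(U,V)>\ell$. (H4) For $F(M,x,\omega)=-A(x,\omega):M$, the family $\{F(\cdot,\cdot,\omega)\}_\omega$ is uniformly equicontinuous on $\{|M|\le K\}\times\mathbb R^d$ for every $K<\infty$, and there are a deterministic continuous modulus $\rho$ and $\sigma>1/2$ with $|F(M,x,\omega)-F(M,y,\omega)|\le\rho((1+|M|)|x-y|^\sigma)$. (H5) With $\lambda(x)=\lambda_{\min}(A(x))$ and $\lambda_*(z)=\inf_{B_1(z)}\lambda$, $\mathbb E[\lambda_*(0)^{-d}]<\infty$. $\bar A$ is the deterministic effective matrix, $0<\bar A\le I$, supplied by the known qualitative homogenization theorem (Armstrong--Smart): for each fixed bounded smooth domain $U$ and smooth $f,g$,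 almost surely the solutions of $-A(x/\varepsilon):D^2u_\varepsilon=f$ in $U$, $u_\varepsilon=g$ on $\partial U$ converge uniformly to the solution of $-\bar A:D^2u_0=f$, $u_0=g$ on $\partial U$. In each realization $A$ is Hölder continuous and uniformly elliptic on $\overline{B_R}$, so all these Dirichlet problems have unique solutions in $C^{2,\theta}(\overline{B_R})$ for some $\theta>0$. *)

theory Defs
  imports "HOL-Probability.Probability"
begin

text \<open>
  The dimension is \<open>CARD('n)\<close>. On \<open>real^'n^'n\<close> the library's \<open>norm\<close> is the Frobenius norm and
  \<open>\<bullet>\<close> is the pairing \<open>M : N\<close>, as the following two facts confirm.
\<close>

type_synonym 'n matrix_field = "real^'n \<Rightarrow> real^'n^'n"

lemma inner_matrix_eq_trace:
  fixes M N :: "real^'n^'n"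
  shows "M \<bullet> N = trace (transpose M ** N)"
  unfolding inner_vec_def trace_def transpose_def matrix_matrix_mult_def
  by (simp, subst sum.swap, simp)

lemma norm_matrix_eq_Frobenius:
  fixes M :: "real^'n^'n"
  shows "norm M = sqrt (\<Sum>i\<in>UNIV. \<Sum>j\<in>UNIV. (M $ i $ j)\<^sup>2)"
  by (simp add: norm_eq_sqrt_inner inner_vec_def power2_eq_square)

subsection \<open>Symmetric matrices\<close>

definition sym_matrix :: "real^'n^'n \<Rightarrow> bool" where
  "sym_matrix M \<longleftrightarrow> transpose M = M"

definition loewner_le :: "real^'n^'n \<Rightarrow> real^'n^'n \<Rightarrow> bool" where
  "loewner_le M N \<longleftrightarrow> (\<forall>v. v \<bullet> (M *v v) \<le> v \<bullet> (N *v v))"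

definition pos_def :: "real^'n^'n \<Rightarrow> bool" where
  "pos_def M \<longleftrightarrow> (\<forall>v. v \<noteq> 0 \<longrightarrow> 0 < v \<bullet> (M *v v))"

definition eigenvalue_of :: "real^'n^'n \<Rightarrow> real \<Rightarrow> bool" where
  "eigenvalue_of M \<mu> \<longleftrightarrow> (\<exists>v. v \<noteq> 0 \<and> M *v v = \<mu> *\<^sub>R v)"

definition lambda_min :: "real^'n^'n \<Rightarrow> real" where
  "lambda_min M = (LEAST \<mu>. eigenvalue_of M \<mu>)"

subsection \<open>The canonical space of continuous matrix fields\<close>

definition continuous_fields :: "'n::finite matrix_field set" where
  "continuous_fields = {A. continuous_on UNIV A}"

text \<open>
  This is the topology of uniform convergence on compact sets. It must not be confused with the
  topology (and \<open>borel\<close>) of the function type, which is that of pointwise convergence.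
\<close>

definition locally_uniform_topology :: "'n::finite matrix_field topology" where
  "locally_uniform_topology = topology (\<lambda>\<U>. \<U> \<subseteq> continuous_fields \<and>
     (\<forall>A\<in>\<U>. \<exists>K e. compact K \<and> 0 < e \<and>
        {B \<in> continuous_fields. \<forall>x\<in>K. dist (B x) (A x) < e} \<subseteq> \<U>))"

lemma openin_locally_uniform_topology:
  "openin locally_uniform_topology \<U> \<longleftrightarrow> \<U> \<subseteq> continuous_fields \<and>
     (\<forall>A\<in>\<U>. \<exists>K e. compact K \<and> 0 < e \<and>
        {B \<in> continuous_fields. \<forall>x\<in>K. dist (B x) (A x) < e} \<subseteq> \<U>)"
proof -
  let ?N = "\<lambda>(A::'a matrix_field) K e. {B \<in> continuous_fields. \<forall>x\<in>K. dist (B x) (A x) < e}"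
  let ?Q = "\<lambda>(\<U>::'a matrix_field set) A. \<exists>K e. compact K \<and> 0 < e \<and> ?N A K e \<subseteq> \<U>"
  have mono: "?Q T A" if "?Q S A" "S \<subseteq> T" for S T A
    using that(1) subset_trans[OF _ that(2)] by fast
  have inter: "?Q (S \<inter> T) A" if S: "?Q S A" and T: "?Q T A" for S T A
  proof -
    obtain K e where 1: "compact K" "0 < e" "?N A K e \<subseteq> S" using S by (elim exE conjE)
    obtain L d where 2: "compact L" "0 < d" "?N A L d \<subseteq> T" using T by (elim exE conjE)
    have "?N A (K \<union> L) (min e d) \<subseteq> ?N A K e \<inter> ?N A L d" by auto
    also have "\<dots> \<subseteq> S \<inter> T" by (rule Int_mono[OF 1(3) 2(3)])
    finally show ?thesis
      using compact_Un[OF 1(1) 2(1)] 1(2) 2(2) by (intro exI[of _ "K \<union> L"] exI[of _ "min e d"]) simp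
  qed
  have "istopology (\<lambda>\<U>. \<U> \<subseteq> continuous_fields \<and> (\<forall>A\<in>\<U>. ?Q \<U> A))"
    unfolding istopology_def
  proof (intro conjI allI impI ballI)
    fix S T A
    assume "S \<subseteq> continuous_fields \<and> (\<forall>A\<in>S. ?Q S A)" "T \<subseteq> continuous_fields \<and> (\<forall>A\<in>T. ?Q T A)"
      and "A \<in> S \<inter> T"
    then have "?Q S A" "?Q T A" by simp_all
    then show "?Q (S \<inter> T) A" by (rule inter)
  next
    fix \<K> A
    assume K: "\<forall>S\<in>\<K>. S \<subseteq> continuous_fields \<and> (\<forall>A\<in>S. ?Q S A)" and "A \<in> \<Union>\<K>"
    then obtain S where S: "S \<in> \<K>" "A \<in> S" by (elim UnionE)
    with K have "?Q S A" by simp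
    then show "?Q (\<Union>\<K>) A" by (rule mono[OF _ Union_upper[OF S(1)]])
  qed (simp_all add: le_infI1 Sup_le_iff)
  then show ?thesis
    unfolding locally_uniform_topology_def by simp
qed

definition field_law :: "'n::finite matrix_field measure \<Rightarrow> bool" where
  "field_law P \<longleftrightarrow> prob_space P \<and> space P = continuous_fields \<and>
     sets P = sigma_sets continuous_fields {\<U>. openin locally_uniform_topology \<U>}"

definition translate :: "real^'n \<Rightarrow> 'n matrix_field \<Rightarrow> 'n matrix_field" where
  "translate z A = (\<lambda>x. A (x + z))"

text \<open>\<open>restriction_sigma U\<close> is \<open>\<sigma>(A|\<^sub>U)\<close>.\<close>

definition restriction_sigma :: "(real^'n) set \<Rightarrow> 'n::finite matrix_field set set" where
  "restriction_sigma U = sigma_sets continuous_fields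
     {{A \<in> continuous_fields. A x \<in> S} | x S. x \<in> U \<and> S \<in> sets borel}"

subsection \<open>Standing assumptions on the law\<close>

definition H1 :: "'n::finite matrix_field measure \<Rightarrow> bool" where
  "H1 P \<longleftrightarrow> (AE A in P. \<forall>x. sym_matrix (A x) \<and> pos_def (A x) \<and> loewner_le (A x) (mat 1))"

definition H2 :: "'n::finite matrix_field measure \<Rightarrow> bool" where
  "H2 P \<longleftrightarrow> (\<forall>z. distr P P (translate z) = P)"

definition H3 :: "'n::finite matrix_field measure \<Rightarrow> bool" where
  "H3 P \<longleftrightarrow> (\<exists>l::real. \<forall>U\<in>sets borel. \<forall>V\<in>sets borel. l < setdist U V \<longrightarrow>
     prob_space.indep_set P (restriction_sigma U) (restriction_sigma V))"

definition op_F :: "'n::finite matrix_field \<Rightarrow> real^'n^'n \<Rightarrow> real^'n \<Rightarrow> real" where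
  "op_F A M x = - (A x \<bullet> M)"

text \<open>
  The canonical space contains all continuous fields, so the two conditions of \<open>H4\<close> on the family
  of realizations are conditions on almost every realization, with deterministic moduli.
\<close>

definition H4 :: "'n::finite matrix_field measure \<Rightarrow> bool" where
  "H4 P \<longleftrightarrow>
     (\<forall>K e. 0 < e \<longrightarrow> (\<exists>\<delta>>0. AE A in P. \<forall>M N x y.
        sym_matrix M \<and> sym_matrix N \<and> norm M \<le> K \<and> norm N \<le> K \<and> dist (M, x) (N, y) < \<delta> \<longrightarrow>
        \<bar>op_F A M x - op_F A N y\<bar> < e)) \<and>
     (\<exists>\<rho> \<sigma>. continuous_on {0..} \<rho> \<and> \<rho> 0 = 0 \<and> 1 / 2 < \<sigma> \<and>
        (AE A in P. \<forall>M x y. sym_matrix M \<longrightarrow>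
           \<bar>op_F A M x - op_F A M y\<bar> \<le> \<rho> ((1 + norm M) * norm (x - y) powr \<sigma>)))"

definition lambda_star :: "'n::finite matrix_field \<Rightarrow> real^'n \<Rightarrow> real" where
  "lambda_star A z = (INF x\<in>ball z 1. lambda_min (A x))"

definition H5 :: "'n::finite matrix_field measure \<Rightarrow> bool" where
  "H5 P \<longleftrightarrow> (\<integral>\<^sup>+ A. inverse (ennreal (lambda_star A 0) ^ CARD('n)) \<partial>P) < \<infinity>"

subsection \<open>The Dirichlet problem\<close>

definition has_hessian_on ::
    "(real^'n \<Rightarrow> real) \<Rightarrow> (real^'n \<Rightarrow> real^'n^'n) \<Rightarrow> (real^'n) set \<Rightarrow> bool" where
  "has_hessian_on u H U \<longleftrightarrow> (\<exists>G. \<forall>x\<in>U.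
     (u has_derivative (\<lambda>h. G x \<bullet> h)) (at x) \<and> (G has_derivative (\<lambda>h. H x *v h)) (at x))"

text \<open>
  \<open>dirichlet_solution U A f g u H\<close>: \<open>u\<close> is a classical solution, with Hessian \<open>H\<close>, of
  \<open>- A : D\<^sup>2u = f\<close> in \<open>U\<close> and \<open>u = g\<close> on the boundary.
\<close>

definition dirichlet_solution :: "(real^'n) set \<Rightarrow> 'n::finite matrix_field \<Rightarrow>
    (real^'n \<Rightarrow> real) \<Rightarrow> (real^'n \<Rightarrow> real) \<Rightarrow> (real^'n \<Rightarrow> real) \<Rightarrow> (real^'n \<Rightarrow> real^'n^'n) \<Rightarrow> bool" where
  "dirichlet_solution U A f g u H \<longleftrightarrow>
     has_hessian_on u H U \<and> continuous_on U H \<and> continuous_on (closure U) u \<and>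
     (\<forall>x\<in>U. - (A x \<bullet> H x) = f x) \<and> (\<forall>x\<in>frontier U. u x = g x)"

text \<open>
  On a ball, a function continuous up to the boundary belongs to \<open>C\<^bsup>2,\<theta>\<^esup>\<close> of the closed ball exactly
  if its Hessian is \<open>\<theta>\<close>-Hoelder continuous on the open ball: the Hessian is then bounded, and it and
  the gradient extend continuously to the closed ball.
\<close>

definition solves_in_ball ::
    "real \<Rightarrow> 'n::finite matrix_field \<Rightarrow> (real^'n \<Rightarrow> real) \<Rightarrow> (real^'n \<Rightarrow> real) \<Rightarrow> bool" where
  "solves_in_ball R A f u \<longleftrightarrow> (\<exists>H \<theta> C. dirichlet_solution (ball 0 R) A f (\<lambda>_. 0) u H \<and>
     0 < \<theta> \<and> \<theta> \<le> 1 \<and>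
     (\<forall>x\<in>ball 0 R. \<forall>y\<in>ball 0 R. norm (H x - H y) \<le> C * norm (x - y) powr \<theta>))"

subsection \<open>The effective matrix\<close>

primrec Ck_on :: "nat \<Rightarrow> (real^'n) set \<Rightarrow> (real^'n \<Rightarrow> real) \<Rightarrow> bool" where
  "Ck_on 0 U f = continuous_on U f"
| "Ck_on (Suc k) U f = (\<exists>G::real^'n \<Rightarrow> real^'n.
     (\<forall>x\<in>U. (f has_derivative (\<lambda>h. G x \<bullet> h)) (at x)) \<and> (\<forall>i. Ck_on k U (\<lambda>x. G x $ i)))"

definition smooth_on :: "(real^'n) set \<Rightarrow> (real^'n \<Rightarrow> real) \<Rightarrow> bool" where
  "smooth_on U f \<longleftrightarrow> (\<forall>k. Ck_on k U f)"

text \<open>Smoothness of the boundary is expressed by local defining functions.\<close>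

definition bounded_smooth_domain :: "(real^'n) set \<Rightarrow> bool" where
  "bounded_smooth_domain U \<longleftrightarrow> open U \<and> connected U \<and> bounded U \<and> U \<noteq> {} \<and>
     (\<forall>p\<in>frontier U. \<exists>W \<phi> G. open W \<and> p \<in> W \<and> smooth_on W \<phi> \<and>
        (\<forall>x\<in>W. (\<phi> has_derivative (\<lambda>h. G x \<bullet> h)) (at x) \<and> G x \<noteq> 0) \<and>
        U \<inter> W = {x\<in>W. \<phi> x < 0})"

definition effective_matrix :: "'n::finite matrix_field measure \<Rightarrow> real^'n^'n \<Rightarrow> bool" where
  "effective_matrix P Abar \<longleftrightarrow>
     sym_matrix Abar \<and> pos_def Abar \<and> loewner_le Abar (mat 1) \<and>
     (\<forall>U f g. bounded_smooth_domain U \<and> smooth_on UNIV f \<and> smooth_on UNIV g \<longrightarrow>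
        (AE A in P. \<forall>u u0.
           (\<forall>\<epsilon>>0. \<exists>H. dirichlet_solution U (\<lambda>x. A (x /\<^sub>R \<epsilon>)) f g (u \<epsilon>) H) \<and>
           (\<exists>H. dirichlet_solution U (\<lambda>_. Abar) f g u0 H) \<longrightarrow>
           uniform_limit U u u0 (at_right (0::real))))"

subsection \<open>The estimator and its error\<close>

definition kappa :: "real \<Rightarrow> 'n::finite matrix_field \<Rightarrow> real" where
  "kappa R A = (LEAST k. k \<in> (\<lambda>x. lambda_min (A x)) ` cball 0 R)"

definition A_hat :: "(real^'n \<Rightarrow> real) \<Rightarrow> ('n \<Rightarrow> 'n \<Rightarrow> real^'n \<Rightarrow> real) \<Rightarrow> real^'n^'n" where
  "A_hat T V = (\<chi> i j. V i j 0 / T 0)"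

definition X_err :: "real \<Rightarrow> (real^'n^'n \<Rightarrow> real^'n \<Rightarrow> real) \<Rightarrow> ereal" where
  "X_err R w = ereal (1 / R\<^sup>2) *
     (SUP M\<in>{M. sym_matrix M \<and> norm M \<le> 1}. esssup (lebesgue_on (ball 0 R)) (\<lambda>x. ereal \<bar>w M x\<bar>))"

end

theory Submission
  imports Defs
begin

text \<open>
  Everything follows from the maximum principle for \<open>- A : D\<^sup>2\<close> with \<open>A\<close> positive definite.
  Linearity of the Dirichlet problem turns \<open>(\<Sum>i j. M\<^bsub>ij\<^esub> V\<^bsub>ij\<^esub>)\<close> into the solution with right-hand side
  \<open>A : M\<close>; comparing it with multiples of \<open>T\<close> for \<open>M = v \<otimes> v\<close> gives the bounds on the estimator.
  For general \<open>M\<close>, subtracting \<open>(Abar : M) T\<close> gives \<open>w\<^bsub>M\<^esub>(0) = T(0) (A_hat - Abar) : M\<close>; the error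
  bound follows with \<open>M\<close> the normalized error, since comparing \<open>T\<close> with \<open>(R\<^sup>2 - |x|\<^sup>2) / (2d)\<close> gives
  \<open>T(0) \<ge> R\<^sup>2 / (2d)\<close>. Measurability follows from continuity: if \<open>B\<close> is uniformly close to \<open>A\<close> on the
  ball, then the torsion function of \<open>A\<close>, whose Hessian is bounded, is a barrier for \<open>B\<close> as well.
\<close>

section \<open>Linear algebra of symmetric and positive semidefinite matrices\<close>

definition outer :: "real^'n \<Rightarrow> real^'n^'n" where
  "outer v = (\<chi> i j. v $ i * v $ j)"

text \<open>Pairing with \<open>outer v\<close> reads off the quadratic form, which is how bounds on
  pairings \<open>A : M\<close> become Loewner bounds.\<close>

lemma inner_outer: "M \<bullet> outer v = v \<bullet> (M *v v)"
  by (simp add: outer_def inner_vec_def matrix_vector_mult_def sum_distrib_left mult_ac)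

lemma outer_mult_vec: "outer v *v w = (v \<bullet> w) *\<^sub>R v"
  by (simp add: vec_eq_iff outer_def inner_vec_def matrix_vector_mult_def sum_distrib_left
      sum_distrib_right mult_ac)

lemma sym_outer: "sym_matrix (outer v)"
  by (simp add: sym_matrix_def outer_def transpose_def vec_eq_iff mult.commute)

lemma sym_matrix_component: "sym_matrix M \<Longrightarrow> M $ i $ j = M $ j $ i"
  by (simp add: sym_matrix_def transpose_def vec_eq_iff)

lemma sym_matrix_inner:
  fixes M :: "real^'n^'n"
  assumes "sym_matrix M"
  shows "v \<bullet> (M *v w) = w \<bullet> (M *v v)"
  using assms by (metis dot_lmul_matrix inner_commute sym_matrix_def transpose_matrix_vector)

lemma sym_matrix_diff: "sym_matrix M \<Longrightarrow> sym_matrix N \<Longrightarrow> sym_matrix (M - N)"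
  by (simp add: sym_matrix_def transpose_def vec_eq_iff)

lemma sym_matrix_scaleR: "sym_matrix M \<Longrightarrow> sym_matrix (c *\<^sub>R M)"
  by (simp add: sym_matrix_def transpose_def vec_eq_iff)

lemma sym_matrix_mat: "sym_matrix (mat c)"
  by (simp add: sym_matrix_def)

lemma quadratic_form_add_scaleR:
  fixes M :: "real^'n^'n"
  assumes "sym_matrix M"
  shows "(v + t *\<^sub>R w) \<bullet> (M *v (v + t *\<^sub>R w)) =
    v \<bullet> (M *v v) + 2 * t * (w \<bullet> (M *v v)) + t\<^sup>2 * (w \<bullet> (M *v w))"
  using sym_matrix_inner[OF assms, of v w]
  by (simp add: matrix_vector_right_distrib inner_add_left inner_add_right
      matrix_vector_mult_scaleR power2_eq_square algebra_simps)

text \<open>A nonnegative quadratic form that vanishes at \<open>v\<close> is minimal there, so its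
  gradient \<open>2 M v\<close> must vanish.\<close>

lemma psd_null_vector:
  fixes M :: "real^'n^'n"
  assumes sym: "sym_matrix M" and psd: "\<And>v. 0 \<le> v \<bullet> (M *v v)"
    and null: "v \<bullet> (M *v v) = 0"
  shows "M *v v = 0"
proof -
  define w where "w = M *v v"
  define s p where "s = w \<bullet> w" and "p = w \<bullet> (M *v w)"
  have p: "0 \<le> p" unfolding p_def by (rule psd)
  \<comment> \<open>For \<open>p > 0\<close> the optimal step along \<open>w\<close> is
    \<open>- s / p\<close>; using \<open>p + 1\<close> avoids a zero denominator and still gives a
    negative value unless \<open>s = 0\<close>.\<close>
  have "0 \<le> 2 * (- s / (p + 1)) * s + (- s / (p + 1))\<^sup>2 * p"
    using psd[of "v + (- s / (p + 1)) *\<^sub>R w"]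
    unfolding quadratic_form_add_scaleR[OF sym] null by (simp add: s_def p_def w_def)
  also have "\<dots> = - (s\<^sup>2 * (p + 2)) / (p + 1)\<^sup>2"
    using p by (simp add: divide_simps power2_eq_square) (simp add: algebra_simps)
  finally have "s\<^sup>2 * (p + 2) \<le> 0"
    using p by (simp add: divide_le_0_iff zero_le_divide_iff)
  then have "s = 0" using p by (simp add: mult_le_0_iff)
  then show ?thesis by (simp add: s_def w_def)
qed

lemma axis_quadratic_form: "axis i 1 \<bullet> (M *v axis i 1) = (M $ i $ i :: real)"
  by (simp add: matrix_vector_mult_basis column_def inner_axis')

text \<open>One step of the Cholesky decomposition removes a diagonal entry at the cost of a rank-one term.\<close>

lemma inner_psd_nonpos:
  fixes M N :: "real^'n^'n"
  assumes sym: "sym_matrix M" and psd: "\<And>v. 0 \<le> v \<bullet> (M *v v)"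
    and N: "\<And>v. v \<bullet> (N *v v) \<le> 0"
  shows "M \<bullet> N \<le> 0"
  using sym psd
\<comment> \<open>Each elimination step lowers the number of nonzero diagonal entries; with none
  left, every basis vector is a null vector and \<open>M = 0\<close>.\<close>
proof (induction "card {i. M $ i $ i \<noteq> 0}" arbitrary: M rule: less_induct)
  case less
  show ?case
  proof (cases "\<exists>i. M $ i $ i \<noteq> 0")
    case False
    then have "M *v axis i 1 = 0" for i
      using psd_null_vector[OF less.prems] axis_quadratic_form[of i M] by fastforce
    then have "M = 0"
      by (simp add: matrix_vector_mult_basis column_def vec_eq_iff)
    then show ?thesis by simp
  next
    case True
    then obtain i where i: "M $ i $ i \<noteq> 0" by blast
    define m a M' where "m = M $ i $ i" and "a = M *v axis i 1"
      and "M' = M - (1 / m) *\<^sub>R outer a"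
    have m: "0 < m"
      using less.prems(2)[of "axis i 1"] i by (simp add: axis_quadratic_form m_def)
    have a: "a $ j = M $ j $ i" for j
      by (simp add: a_def matrix_vector_mult_basis column_def)
    have sym': "sym_matrix M'"
      unfolding M'_def by (intro sym_matrix_diff sym_matrix_scaleR sym_outer less.prems(1))
    have psd': "0 \<le> v \<bullet> (M' *v v)" for v
    proof -
      \<comment> \<open>This \<open>t\<close> minimizes the form of \<open>M\<close> along the line
        through \<open>v\<close> in direction \<open>axis i 1\<close>, and the minimum is the form
        of \<open>M'\<close> at \<open>v\<close>.\<close>
      define t where "t = - (v \<bullet> a) / m"
      have "axis i 1 \<bullet> (M *v v) = v \<bullet> a"
        unfolding a_def by (rule sym_matrix_inner[OF less.prems(1)])
      then have "0 \<le> v \<bullet> (M *v v) + 2 * t * (v \<bullet> a) + t\<^sup>2 * m"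
        using less.prems(2)[of "v + t *\<^sub>R axis i 1"]
        by (simp only: quadratic_form_add_scaleR[OF less.prems(1)] axis_quadratic_form m_def)
      also have "\<dots> = v \<bullet> (M *v v) - (v \<bullet> a)\<^sup>2 / m"
        using m by (simp add: t_def divide_simps power2_eq_square)
      also have "\<dots> = v \<bullet> (M' *v v)"
        by (simp add: M'_def matrix_vector_mult_diff_rdistrib scaleR_matrix_vector_assoc[symmetric]
            outer_mult_vec inner_diff_right inner_commute power2_eq_square)
      finally show ?thesis .
    qed
    \<comment> \<open>The pivot entry becomes zero and no new nonzero entry appears: a zero diagonal
      entry of a positive semidefinite matrix makes its whole column vanish, so
      \<open>a $ j = 0\<close> there.\<close>
    have "{j. M' $ j $ j \<noteq> 0} \<subset> {j. M $ j $ j \<noteq> 0}"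
    proof
      have "M' $ j $ j = 0" if j: "M $ j $ j = 0" for j
      proof -
        have "M *v axis j 1 = 0"
          using j by (intro psd_null_vector less.prems) (simp add: axis_quadratic_form)
        then have "M $ i $ j = 0"
          by (simp add: matrix_vector_mult_basis column_def vec_eq_iff)
        then show ?thesis
          using j sym_matrix_component[OF less.prems(1), of i j] by (simp add: M'_def outer_def a)
      qed
      then show "{j. M' $ j $ j \<noteq> 0} \<subseteq> {j. M $ j $ j \<noteq> 0}" by blast
      have "M' $ i $ i = 0" using m by (simp add: M'_def outer_def a m_def)
      then show "{j. M' $ j $ j \<noteq> 0} \<noteq> {j. M $ j $ j \<noteq> 0}" using i by blast
    qed
    then have "M' \<bullet> N \<le> 0"
      by (intro less.hyps sym' psd' psubset_card_mono) simp_all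
    moreover have "M \<bullet> N = M' \<bullet> N + (a \<bullet> (N *v a)) / m"
      by (simp add: M'_def inner_diff_left inner_outer inner_commute[of _ N] inner_diff_right)
    moreover have "(a \<bullet> (N *v a)) / m \<le> 0"
      using N[of a] m by (simp add: divide_le_0_iff)
    ultimately show ?thesis by linarith
  qed
qed

section \<open>The smallest eigenvalue and its minimum over a ball\<close>

text \<open>The minimum \<open>\<mu>\<close> of the form over the unit sphere is an eigenvalue:
  \<open>M - \<mu> I\<close> is positive semidefinite and its form vanishes at the minimizer, which
  is therefore a null vector. No eigenvalue is smaller, so the \<open>LEAST\<close> in
  \<open>lambda_min\<close> is attained.\<close>

lemma lambda_min_Rayleigh:
  fixes M :: "real^'n^'n"
  assumes sym: "sym_matrix M"
  shows "\<exists>v. norm v = 1 \<and> lambda_min M = v \<bullet> (M *v v)"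
    and "lambda_min M * (w \<bullet> w) \<le> w \<bullet> (M *v w)"
proof -
  have "continuous_on (sphere 0 1) (\<lambda>v. v \<bullet> (M *v v))"
    by (intro continuous_intros matrix_vector_mult_linear_continuous_on)
  moreover have "sphere (0::real^'n) 1 \<noteq> {}"
    by simp
  ultimately obtain v where v: "norm v = 1"
    and min: "\<And>w. norm w = 1 \<Longrightarrow> v \<bullet> (M *v v) \<le> w \<bullet> (M *v w)"
    using continuous_attains_inf[of "sphere 0 1" "\<lambda>v. v \<bullet> (M *v v)"] by auto
  define \<mu> where "\<mu> = v \<bullet> (M *v v)"
  have low: "\<mu> * (w \<bullet> w) \<le> w \<bullet> (M *v w)" for w
  proof (cases "w = 0")
    case False
    then have "\<mu> \<le> (w /\<^sub>R norm w) \<bullet> (M *v (w /\<^sub>R norm w))"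
      unfolding \<mu>_def by (intro min) simp
    then show ?thesis
      using False by (simp add: matrix_vector_mult_scaleR dot_square_norm field_simps power2_eq_square)
  qed simp
  define N where "N = M - \<mu> *\<^sub>R mat 1"
  have N: "N *v w = M *v w - \<mu> *\<^sub>R w" for w
    by (simp add: N_def matrix_vector_mult_diff_rdistrib scaleR_matrix_vector_assoc[symmetric])
  have "N *v v = 0"
  proof (rule psd_null_vector)
    show "sym_matrix N"
      unfolding N_def by (intro sym_matrix_diff sym_matrix_scaleR sym_matrix_mat sym)
    show "0 \<le> w \<bullet> (N *v w)" for w
      using low[of w] by (simp add: N inner_diff_right)
    show "v \<bullet> (N *v v) = 0"
      using v by (simp add: N inner_diff_right \<mu>_def dot_square_norm)
  qed
  then have "eigenvalue_of M \<mu>"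
    unfolding eigenvalue_of_def using v by (intro exI[of _ v]) (auto simp: N)
  moreover have "\<mu> \<le> \<nu>" if "eigenvalue_of M \<nu>" for \<nu>
    using that low unfolding eigenvalue_of_def
    by (metis inner_gt_zero_iff inner_scaleR_right mult_le_cancel_right_pos)
  ultimately have "lambda_min M = \<mu>"
    unfolding lambda_min_def by (rule Least_equality)
  then show "\<exists>v. norm v = 1 \<and> lambda_min M = v \<bullet> (M *v v)"
    and "lambda_min M * (w \<bullet> w) \<le> w \<bullet> (M *v w)"
    using v low \<mu>_def by auto
qed

text \<open>Minimizing the form jointly in the point and the unit vector, over a compact product,
  bypasses continuity of \<open>lambda_min\<close> and shows that the \<open>LEAST\<close> in
  \<open>kappa\<close> is a true minimum.\<close>

lemma kappa_attained:
  fixes A :: "'n::finite matrix_field"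
  assumes cont: "continuous_on UNIV A" and sym: "\<And>x. sym_matrix (A x)" and "0 \<le> R"
  shows "\<exists>x\<in>cball 0 R. kappa R A = lambda_min (A x)"
    and "x \<in> cball 0 R \<Longrightarrow> kappa R A \<le> lambda_min (A x)"
proof -
  let ?K = "cball (0::real^'n) R \<times> sphere (0::real^'n) 1"
  have "continuous_on ?K (\<lambda>p. A (fst p))"
    by (rule continuous_on_compose2[OF cont]) (auto intro: continuous_intros)
  then have "continuous_on ?K (\<lambda>p. snd p \<bullet> (A (fst p) *v snd p))"
    unfolding matrix_vector_mult_def inner_vec_def by (intro continuous_intros)
  moreover have "compact ?K"
    by (intro compact_Times) auto
  moreover have "?K \<noteq> {}"
    using \<open>0 \<le> R\<close> by auto
  ultimately obtain p where p: "p \<in> ?K"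
    and min: "\<And>q. q \<in> ?K \<Longrightarrow> snd p \<bullet> (A (fst p) *v snd p) \<le> snd q \<bullet> (A (fst q) *v snd q)"
    using continuous_attains_inf[of ?K "\<lambda>p. snd p \<bullet> (A (fst p) *v snd p)"] by blast
  have least: "lambda_min (A (fst p)) \<le> lambda_min (A x)" if x: "x \<in> cball 0 R" for x
  proof -
    obtain v where v: "norm v = 1" "lambda_min (A x) = v \<bullet> (A x *v v)"
      using lambda_min_Rayleigh(1)[OF sym] by blast
    have "lambda_min (A (fst p)) \<le> snd p \<bullet> (A (fst p) *v snd p)"
      using lambda_min_Rayleigh(2)[OF sym, of "fst p" "snd p"] p by (auto simp: dot_square_norm)
    also have "\<dots> \<le> lambda_min (A x)"
      using min[of "(x, v)"] v x by simp
    finally show ?thesis .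
  qed
  have "kappa R A = lambda_min (A (fst p))"
    unfolding kappa_def using p least by (intro Least_equality) auto
  then show "\<exists>x\<in>cball 0 R. kappa R A = lambda_min (A x)"
    and "x \<in> cball 0 R \<Longrightarrow> kappa R A \<le> lambda_min (A x)"
    using p least by auto
qed

section \<open>The maximum principle\<close>

text \<open>Along the line through \<open>x\<close> in direction \<open>v\<close>, the first
  derivative \<open>\<psi>\<close> vanishes at \<open>0\<close>. A positive second derivative would
  make \<open>\<psi>\<close> positive just after \<open>0\<close>, and the mean value theorem would
  produce a value above the maximum.\<close>

lemma second_derivative_test:
  fixes G :: "real^'n::finite \<Rightarrow> real^'n"
  assumes U: "open U" "x \<in> U"
    and u: "\<And>y. y \<in> U \<Longrightarrow> (u has_derivative (\<lambda>h. G y \<bullet> h)) (at y)"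
    and G: "(G has_derivative (\<lambda>h. H *v h)) (at x)"
    and max: "\<And>y. y \<in> U \<Longrightarrow> u y \<le> u x"
  shows "v \<bullet> (H *v v) \<le> 0"
proof (rule ccontr)
  assume "\<not> ?thesis"
  then have pos: "0 < v \<bullet> (H *v v)" by simp
  define \<phi> where "\<phi> t = u (x + t *\<^sub>R v)" for t :: real
  define \<psi> where "\<psi> t = G (x + t *\<^sub>R v) \<bullet> v" for t :: real
  have \<phi>: "(\<phi> has_real_derivative \<psi> t) (at t)" if "x + t *\<^sub>R v \<in> U" for t
  proof -
    have "(\<phi> has_derivative (\<lambda>s. G (x + t *\<^sub>R v) \<bullet> (s *\<^sub>R v))) (at t)"
      unfolding \<phi>_def
    proof (rule has_derivative_compose[where f = "\<lambda>t. x + t *\<^sub>R v"])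
      show "((\<lambda>t. x + t *\<^sub>R v) has_derivative (\<lambda>s. s *\<^sub>R v)) (at t)"
        by (auto intro!: derivative_eq_intros)
    qed (rule u[OF that])
    then show ?thesis
      unfolding has_field_derivative_def \<psi>_def
      by (rule has_derivative_eq_rhs) (auto simp: mult.commute)
  qed
  have "((\<lambda>t. G (x + t *\<^sub>R v)) has_derivative (\<lambda>t. H *v (t *\<^sub>R v))) (at 0)"
  proof (rule has_derivative_compose[where f = "\<lambda>t. x + t *\<^sub>R v" and f' = "\<lambda>t. t *\<^sub>R v"
        and g' = "(*v) H"])
    show "((\<lambda>t. x + t *\<^sub>R v) has_derivative (\<lambda>t. t *\<^sub>R v)) (at 0)"
      by (auto intro!: derivative_eq_intros)
  qed (use G in simp)
  then have "(\<psi> has_derivative (\<lambda>t. (H *v (t *\<^sub>R v)) \<bullet> v)) (at 0)"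
    unfolding \<psi>_def by (rule has_derivative_inner_left)
  then have \<psi>: "(\<psi> has_real_derivative v \<bullet> (H *v v)) (at 0)"
    unfolding has_field_derivative_def
    by (rule has_derivative_eq_rhs) (auto simp: matrix_vector_mult_scaleR inner_commute)
  have zero: "\<psi> 0 = 0"
  proof -
    have "(\<lambda>h. G x \<bullet> h) = (\<lambda>h. 0)"
      using differential_zero_maxmin[OF U(2) U(1) u[OF U(2)]] max by blast
    then show ?thesis unfolding \<psi>_def by (metis add.right_neutral scaleR_zero_left)
  qed
  obtain d where d: "0 < d" "\<And>h. 0 < h \<Longrightarrow> h < d \<Longrightarrow> 0 < \<psi> h"
    using DERIV_pos_inc_right[OF \<psi> pos] zero by auto
  obtain e where e: "0 < e" "ball x e \<subseteq> U"
    using U openE by blast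
  \<comment> \<open>The first bound keeps \<open>\<psi>\<close> positive, the second keeps the
    segment inside \<open>ball x e\<close>.\<close>
  define t where "t = min (d / 2) (e / (2 * (norm v + 1)))"
  have nv: "0 < norm v + 1" by (simp add: add_nonneg_pos)
  have t: "0 < t" "t < d"
    using d(1) e(1) nv by (auto simp: t_def)
  have inU: "x + s *\<^sub>R v \<in> U" if "0 \<le> s" "s \<le> t" for s
  proof -
    have "s * norm v \<le> e / (2 * (norm v + 1)) * norm v"
      using that by (intro mult_right_mono) (auto simp: t_def)
    also have "\<dots> < e"
      using e(1) nv by (simp add: divide_simps)
    finally have "x + s *\<^sub>R v \<in> ball x e"
      using that by (simp add: dist_norm)
    then show ?thesis using e(2) by blast
  qed
  obtain z where z: "0 < z" "z < t" "\<phi> t - \<phi> 0 = (t - 0) * \<psi> z"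
    using MVT2[OF t(1), of \<phi> \<psi>] \<phi> inU by auto
  have "\<phi> 0 < \<phi> t"
    using z d(2)[of z] t by (smt (verit) mult_pos_pos)
  moreover have "\<phi> t \<le> \<phi> 0"
    using max[OF inU[of t]] t by (simp add: \<phi>_def)
  ultimately show False by simp
qed

lemma has_hessian_on_add:
  "has_hessian_on u H U \<Longrightarrow> has_hessian_on v K U \<Longrightarrow>
    has_hessian_on (\<lambda>x. u x + v x) (\<lambda>x. H x + K x) U"
  unfolding has_hessian_on_def
proof (elim exE)
  fix G G'
  assume "\<forall>x\<in>U. (u has_derivative (\<bullet>) (G x)) (at x) \<and> (G has_derivative (*v) (H x)) (at x)"
    and "\<forall>x\<in>U. (v has_derivative (\<bullet>) (G' x)) (at x) \<and> (G' has_derivative (*v) (K x)) (at x)"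
  then show "\<exists>G. \<forall>x\<in>U. ((\<lambda>x. u x + v x) has_derivative (\<bullet>) (G x)) (at x) \<and>
      (G has_derivative (*v) (H x + K x)) (at x)"
    by (intro exI[of _ "\<lambda>x. G x + G' x"])
       (auto intro!: derivative_eq_intros simp: inner_add_left matrix_vector_mult_add_rdistrib)
qed

lemma has_hessian_on_scale:
  "has_hessian_on u H U \<Longrightarrow> has_hessian_on (\<lambda>x. c * u x) (\<lambda>x. c *\<^sub>R H x) U"
  unfolding has_hessian_on_def
proof (elim exE)
  fix G
  assume "\<forall>x\<in>U. (u has_derivative (\<bullet>) (G x)) (at x) \<and> (G has_derivative (*v) (H x)) (at x)"
  then show "\<exists>G. \<forall>x\<in>U. ((\<lambda>x. c * u x) has_derivative (\<bullet>) (G x)) (at x) \<and>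
      (G has_derivative (*v) (c *\<^sub>R H x)) (at x)"
    by (intro exI[of _ "\<lambda>x. c *\<^sub>R G x"])
       (auto intro!: derivative_eq_intros simp: scaleR_matrix_vector_assoc)
qed

lemma has_hessian_on_norm_square:
  "has_hessian_on (\<lambda>x. (norm x)\<^sup>2) (\<lambda>x. 2 *\<^sub>R mat 1) U"
  unfolding has_hessian_on_def power2_norm_eq_inner
  by (intro exI[of _ "\<lambda>x. 2 *\<^sub>R x"] ballI conjI)
     (auto intro!: derivative_eq_intros simp: scaleR_matrix_vector_assoc[symmetric] inner_commute)

lemma inner_mat_1: "M \<bullet> mat 1 = (trace M :: real)"
  by (simp add: inner_vec_def trace_def mat_def if_distrib[where f = "\<lambda>x. _ * x"] cong: if_cong)

lemma trace_pos_def: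
  fixes M :: "real^'n^'n"
  assumes "pos_def M"
  shows "0 < trace M"
proof -
  have "0 < M $ i $ i" for i
    using assms axis_quadratic_form[of i M] unfolding pos_def_def
    by (metis axis_eq_0_iff zero_neq_one)
  then show ?thesis by (simp add: trace_def sum_pos)
qed

lemma trace_le_card:
  fixes M :: "real^'n^'n"
  assumes "loewner_le M (mat 1)"
  shows "trace M \<le> real CARD('n)"
proof -
  have "M $ i $ i \<le> 1" for i
    using assms[unfolded loewner_le_def, rule_format, of "axis i 1"]
    by (simp add: axis_quadratic_form)
  then have "trace M \<le> (\<Sum>i\<in>(UNIV::'n set). 1)"
    unfolding trace_def by (intro sum_mono)
  then show ?thesis by simp
qed

text \<open>Adding \<open>c |x|^2\<close> makes the subsolution strict, since \<open>A\<close> has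
  positive trace. At an interior maximum the Hessian is negative semidefinite and its pairing with
  \<open>A\<close> nonpositive, a contradiction; so the maximum lies on the boundary, and
  \<open>c\<close> can be taken arbitrarily small.\<close>

theorem maximum_principle:
  fixes A :: "'n::finite matrix_field"
  assumes U: "open U" "bounded U"
    and A: "\<And>x. x \<in> U \<Longrightarrow> sym_matrix (A x)" "\<And>x. x \<in> U \<Longrightarrow> pos_def (A x)"
    and u: "has_hessian_on u H U" "continuous_on (closure U) u"
    and sub: "\<And>x. x \<in> U \<Longrightarrow> 0 \<le> A x \<bullet> H x"
    and bd: "\<And>x. x \<in> frontier U \<Longrightarrow> u x \<le> 0"
    and x: "x \<in> closure U"
  shows "u x \<le> 0"
proof (rule field_le_epsilon)
  fix e :: real assume "0 < e"
  obtain r where r: "\<And>x. x \<in> closure U \<Longrightarrow> norm x \<le> r"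
    using U(2) bounded_closure[of U] unfolding bounded_iff by blast
  \<comment> \<open>Chosen so that the correction is at most \<open>c * (r\<^sup>2 + 1) = e\<close>
    on the closure.\<close>
  define c where "c = e / (r\<^sup>2 + 1)"
  have c: "0 < c" unfolding c_def using \<open>0 < e\<close> by (simp add: add_nonneg_pos)
  define v where "v y = u y + c * (norm y)\<^sup>2" for y
  have v: "has_hessian_on v (\<lambda>x. H x + c *\<^sub>R (2 *\<^sub>R mat 1)) U"
    unfolding v_def by (intro has_hessian_on_add has_hessian_on_scale has_hessian_on_norm_square u)
  have "continuous_on (closure U) v"
    unfolding v_def by (intro continuous_intros u)
  moreover have "compact (closure U)" "closure U \<noteq> {}"
    using U(2) x by (auto simp: compact_closure)
  ultimately obtain y where y: "y \<in> closure U" and max: "\<And>z. z \<in> closure U \<Longrightarrow> v z \<le> v y"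
    using continuous_attains_sup[of "closure U" v] by blast
  have "y \<notin> U"
  proof
    assume yU: "y \<in> U"
    obtain G where G: "\<And>z. z \<in> U \<Longrightarrow> (v has_derivative (\<lambda>h. G z \<bullet> h)) (at z)"
      "\<And>z. z \<in> U \<Longrightarrow> (G has_derivative (\<lambda>h. (H z + c *\<^sub>R (2 *\<^sub>R mat 1)) *v h)) (at z)"
      using v unfolding has_hessian_on_def by blast
    have "A y \<bullet> (H y + c *\<^sub>R (2 *\<^sub>R mat 1)) \<le> 0"
    proof (rule inner_psd_nonpos[OF A(1)[OF yU]])
      show "0 \<le> h \<bullet> (A y *v h)" for h
        using A(2)[OF yU] unfolding pos_def_def by (cases "h = 0") (auto intro: less_imp_le)
      show "h \<bullet> ((H y + c *\<^sub>R (2 *\<^sub>R mat 1)) *v h) \<le> 0" for h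
        using max closure_subset[of U]
        by (intro second_derivative_test[OF U(1) yU G(1) G(2)[OF yU]]) auto
    qed
    then show False
      using sub[OF yU] c trace_pos_def[OF A(2)[OF yU]]
      by (simp add: inner_add_right inner_mat_1) (smt (verit) mult_pos_pos)
  qed
  then have "y \<in> frontier U"
    using y U(1) by (simp add: frontier_def interior_open)
  have "u x \<le> v x"
    using c by (simp add: v_def)
  also have "\<dots> \<le> v y"
    by (rule max[OF x])
  also have "\<dots> \<le> 0 + c * (norm y)\<^sup>2"
    unfolding v_def using bd[OF \<open>y \<in> frontier U\<close>] by simp
  also have "\<dots> \<le> 0 + c * (r\<^sup>2 + 1)"
    using c power_mono[OF r[OF y] norm_ge_zero, of 2] by (auto intro!: mult_left_mono)
  also have "\<dots> = 0 + e"
    unfolding c_def by (simp add: add_nonneg_pos less_imp_neq[symmetric])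
  finally show "u x \<le> 0 + e" .
qed

section \<open>Linearity and comparison for the Dirichlet problem\<close>

lemma dirichlet_solution_add:
  assumes "dirichlet_solution U A f g u H" "dirichlet_solution U A f' g' v K"
  shows "dirichlet_solution U A (\<lambda>x. f x + f' x) (\<lambda>x. g x + g' x) (\<lambda>x. u x + v x) (\<lambda>x. H x + K x)"
proof -
  have "- (A x \<bullet> (H x + K x)) = f x + f' x" if "x \<in> U" for x
  proof -
    have "- (A x \<bullet> H x) = f x" "- (A x \<bullet> K x) = f' x"
      using assms that unfolding dirichlet_solution_def by blast+
    then show ?thesis by (simp add: inner_add_right)
  qed
  moreover have "has_hessian_on (\<lambda>x. u x + v x) (\<lambda>x. H x + K x) U"
    using assms unfolding dirichlet_solution_def by (intro has_hessian_on_add) blast+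
  ultimately show ?thesis
    using assms by (auto simp: dirichlet_solution_def intro!: continuous_intros)
qed

lemma dirichlet_solution_scale:
  assumes "dirichlet_solution U A f g u H"
  shows "dirichlet_solution U A (\<lambda>x. c * f x) (\<lambda>x. c * g x) (\<lambda>x. c * u x) (\<lambda>x. c *\<^sub>R H x)"
proof -
  have "- (A x \<bullet> (c *\<^sub>R H x)) = c * f x" if "x \<in> U" for x
  proof -
    have "f x = - (A x \<bullet> H x)"
      using assms that unfolding dirichlet_solution_def by metis
    then show ?thesis by simp
  qed
  moreover have "has_hessian_on (\<lambda>x. c * u x) (\<lambda>x. c *\<^sub>R H x) U"
    using assms unfolding dirichlet_solution_def by (intro has_hessian_on_scale) blast
  ultimately show ?thesis
    using assms by (auto simp: dirichlet_solution_def intro!: continuous_intros)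
qed

lemma dirichlet_solution_zero: "dirichlet_solution U A (\<lambda>_. 0) (\<lambda>_. 0) (\<lambda>_. 0) (\<lambda>_. 0)"
  unfolding dirichlet_solution_def has_hessian_on_def
  by (auto intro!: exI[of _ "\<lambda>_. 0"] derivative_eq_intros continuous_intros)

lemma dirichlet_solution_sum:
  assumes "\<And>i. i \<in> I \<Longrightarrow> dirichlet_solution U A (f i) (g i) (u i) (H i)"
  shows "dirichlet_solution U A (\<lambda>x. \<Sum>i\<in>I. f i x) (\<lambda>x. \<Sum>i\<in>I. g i x) (\<lambda>x. \<Sum>i\<in>I. u i x)
    (\<lambda>x. \<Sum>i\<in>I. H i x)"
proof (cases "finite I")
  case True
  from True assms show ?thesis
    by (induction I) (simp_all add: dirichlet_solution_zero dirichlet_solution_add)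
next
  case False
  then show ?thesis by (simp add: dirichlet_solution_zero)
qed

text \<open>The change of coefficients is absorbed into the right-hand side, so that solutions for
  two different operators can be compared through the maximum principle of one of them.\<close>

lemma dirichlet_solution_change_operator:
  assumes "dirichlet_solution U A f g u H"
  shows "dirichlet_solution U B (\<lambda>x. f x + (A x - B x) \<bullet> H x) g u H"
proof -
  have "- (B x \<bullet> H x) = f x + (A x - B x) \<bullet> H x" if "x \<in> U" for x
  proof -
    have "- (A x \<bullet> H x) = f x"
      using assms that unfolding dirichlet_solution_def by blast
    then show ?thesis by (simp only: inner_diff_left)
  qed
  then show ?thesis
    using assms unfolding dirichlet_solution_def by blast
qed

text \<open>The difference \<open>u - v\<close> is a subsolution with nonpositive boundary
  values.\<close>

theorem dirichlet_comparison:
  assumes U: "open U" "bounded U"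
    and A: "\<And>x. x \<in> U \<Longrightarrow> sym_matrix (A x)" "\<And>x. x \<in> U \<Longrightarrow> pos_def (A x)"
    and u: "dirichlet_solution U A f g u H"
    and v: "dirichlet_solution U A f' g' v K"
    and f: "\<And>x. x \<in> U \<Longrightarrow> f x \<le> f' x"
    and g: "\<And>x. x \<in> frontier U \<Longrightarrow> g x \<le> g' x"
    and x: "x \<in> closure U"
  shows "u x \<le> v x"
proof -
  have d: "dirichlet_solution U A (\<lambda>x. f x + -1 * f' x) (\<lambda>x. g x + -1 * g' x) (\<lambda>x. u x + -1 * v x)
      (\<lambda>x. H x + -1 *\<^sub>R K x)"
    by (intro dirichlet_solution_add dirichlet_solution_scale u v)
  have "u x + -1 * v x \<le> 0"
  proof (rule maximum_principle[OF U A])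
    show "has_hessian_on (\<lambda>x. u x + -1 * v x) (\<lambda>x. H x + -1 *\<^sub>R K x) U"
      "continuous_on (closure U) (\<lambda>x. u x + -1 * v x)"
      using d unfolding dirichlet_solution_def by blast+
    show "0 \<le> A y \<bullet> (H y + -1 *\<^sub>R K y)" if "y \<in> U" for y
    proof -
      have "- (A y \<bullet> (H y + -1 *\<^sub>R K y)) = f y + -1 * f' y"
        using d that unfolding dirichlet_solution_def by blast
      then show ?thesis using f[OF that] by linarith
    qed
    show "u y + -1 * v y \<le> 0" if "y \<in> frontier U" for y
    proof -
      have "u y + -1 * v y = g y + -1 * g' y"
        using d that unfolding dirichlet_solution_def by blast
      then show ?thesis using g[OF that] by linarith
    qed
  qed (use x in auto)
  then show ?thesis by simp
qed

section \<open>Problems in a ball: Hessian bounds, the torsion function, uniqueness\<close>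

text \<open>Hoelder continuity on a bounded set bounds the Hessian by its value at the centre plus a
  multiple of \<open>R powr \<theta>\<close>. The bound serves stability, where the Hessian
  multiplies the perturbation of the coefficients.\<close>

lemma solves_in_ball_bounded_hessian:
  assumes "solves_in_ball R A f u"
  shows "\<exists>H C. dirichlet_solution (ball 0 R) A f (\<lambda>_. 0) u H \<and> 0 \<le> C \<and>
    (\<forall>x\<in>ball 0 R. norm (H x) \<le> C)"
proof -
  obtain H \<theta> C where H: "dirichlet_solution (ball 0 R) A f (\<lambda>_. 0) u H" and \<theta>: "0 < \<theta>"
    and hol: "\<And>x y. x \<in> ball 0 R \<Longrightarrow> y \<in> ball 0 R \<Longrightarrow> norm (H x - H y) \<le> C * norm (x - y) powr \<theta>"
    using assms unfolding solves_in_ball_def by blast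
  have "norm (H x) \<le> norm (H 0) + \<bar>C\<bar> * R powr \<theta>" if x: "x \<in> ball 0 R" for x
  proof -
    have xR: "norm x \<le> R" "0 \<in> ball (0::real^'n) R"
      using x by (auto intro: le_less_trans[OF norm_ge_zero])
    have "norm (H x) \<le> norm (H 0) + norm (H x - H 0)"
      using norm_triangle_sub by blast
    also have "norm (H x - H 0) \<le> C * norm x powr \<theta>"
      using hol[OF x xR(2)] by simp
    \<comment> \<open>The sign of \<open>C\<close> is not prescribed in
      \<open>solves_in_ball\<close>, so it is replaced by its absolute value before the monotonicity
      in \<open>norm x\<close> is used.\<close>
    also have "\<dots> \<le> \<bar>C\<bar> * norm x powr \<theta>"
      by (intro mult_right_mono) auto
    also have "\<dots> \<le> \<bar>C\<bar> * R powr \<theta>"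
      using xR \<theta> by (intro mult_left_mono powr_mono2) auto
    finally show ?thesis by simp
  qed
  moreover have "0 \<le> norm (H 0) + \<bar>C\<bar> * R powr \<theta>" by simp
  ultimately show ?thesis using H by blast
qed

text \<open>The paraboloid has a constant multiple of the identity as Hessian, so it is an explicit
  solution for every coefficient field.\<close>

lemma dirichlet_solution_torsion_barrier:
  assumes "0 < R"
  shows "dirichlet_solution (ball 0 R) A (\<lambda>x. 2 * c * trace (A x)) (\<lambda>_. 0)
    (\<lambda>x. c * (R\<^sup>2 - (norm x)\<^sup>2)) (\<lambda>x. - (2 * c) *\<^sub>R mat 1)"
proof -
  have "has_hessian_on (\<lambda>_. c * R\<^sup>2) (\<lambda>_. 0) (ball 0 R)"
    unfolding has_hessian_on_def by (intro exI[of _ "\<lambda>_. 0"]) (auto intro!: derivative_eq_intros)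
  from has_hessian_on_add[OF this has_hessian_on_scale[OF has_hessian_on_norm_square, of "- c"]]
  have "has_hessian_on (\<lambda>x. c * (R\<^sup>2 - (norm x)\<^sup>2)) (\<lambda>x. - (2 * c) *\<^sub>R mat 1) (ball 0 R)"
    by (simp add: algebra_simps)
  then show ?thesis
    using assms by (auto simp: dirichlet_solution_def inner_mat_1 intro!: continuous_intros)
qed

text \<open>As \<open>A \<le> I\<close>, its trace is at most the dimension, so the paraboloid with
  \<open>?c\<close> has right-hand side at most \<open>1\<close> and lies below \<open>T\<close>.
  This is the source of the constant in the error bound.\<close>

lemma torsion_lower_bound:
  fixes A :: "'n::finite matrix_field"
  assumes R: "0 < R"
    and A: "\<And>x. sym_matrix (A x)" "\<And>x. pos_def (A x)" "\<And>x. loewner_le (A x) (mat 1)"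
    and T: "dirichlet_solution (ball 0 R) A (\<lambda>_. 1) (\<lambda>_. 0) T H"
  shows "R\<^sup>2 / (2 * real CARD('n)) \<le> T 0"
proof -
  let ?c = "1 / (2 * real CARD('n))"
  have "?c * (R\<^sup>2 - (norm (0::real^'n))\<^sup>2) \<le> T 0"
  proof (rule dirichlet_comparison[OF _ _ _ _ dirichlet_solution_torsion_barrier[OF R] T])
    show "2 * ?c * trace (A x) \<le> 1" for x
      using trace_le_card[OF A(3), of x] by (simp add: divide_le_eq)
  qed (use A R in auto)
  then show ?thesis by simp
qed

lemma solves_in_ball_unique:
  assumes "0 < R" "\<And>x. sym_matrix (A x)" "\<And>x. pos_def (A x)"
    and "solves_in_ball R A f u" "solves_in_ball R A f v" "x \<in> cball 0 R"
  shows "u x = v x"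
proof -
  obtain H K where u: "dirichlet_solution (ball 0 R) A f (\<lambda>_. 0) u H"
    and v: "dirichlet_solution (ball 0 R) A f (\<lambda>_. 0) v K"
    using assms unfolding solves_in_ball_def by blast
  have x: "x \<in> closure (ball 0 R)"
    using assms by simp
  show ?thesis
    by (rule order_antisym; rule dirichlet_comparison[where A = A and U = "ball 0 R"])
      (fact | simp add: assms)+
qed

lemma kappa_pos:
  assumes "continuous_on UNIV A" "\<And>x. sym_matrix (A x)" "\<And>x. pos_def (A x)" "0 \<le> R"
  shows "0 < kappa R A"
proof -
  obtain x where "kappa R A = lambda_min (A x)"
    using kappa_attained(1)[OF assms(1,2,4)] by blast
  moreover obtain v where "norm v = 1" "lambda_min (A x) = v \<bullet> (A x *v v)"
    using lambda_min_Rayleigh(1)[OF assms(2)] by blast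
  ultimately show ?thesis
    using assms(3)[of x] unfolding pos_def_def by (metis norm_zero zero_neq_one)
qed

section \<open>The estimator in one realization and one ball\<close>

locale ball_estimator =
  fixes A :: "'n::finite matrix_field" and R :: real
    and T :: "real^'n \<Rightarrow> real" and V :: "'n \<Rightarrow> 'n \<Rightarrow> real^'n \<Rightarrow> real"
  assumes R: "0 < R"
    and sym: "\<And>x. sym_matrix (A x)"
    and pos: "\<And>x. pos_def (A x)"
    and le_id: "\<And>x. loewner_le (A x) (mat 1)"
    and T: "solves_in_ball R A (\<lambda>_. 1) T"
    and V: "\<And>i j. solves_in_ball R A (\<lambda>x. A x $ i $ j) (V i j)"
begin

lemma T_solution: "\<exists>H. dirichlet_solution (ball 0 R) A (\<lambda>_. 1) (\<lambda>_. 0) T H"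
  using T unfolding solves_in_ball_def by blast

lemma T_center_ge: "R\<^sup>2 / (2 * real CARD('n)) \<le> T 0"
  using torsion_lower_bound[where A = A, OF R sym pos le_id] T_solution by blast

lemma T_center_pos: "0 < T 0"
proof -
  have "0 < R\<^sup>2 / (2 * real CARD('n))" using R by simp
  then show ?thesis using T_center_ge by linarith
qed

lemma combination_solution:
  "\<exists>H. dirichlet_solution (ball 0 R) A (\<lambda>x. A x \<bullet> M) (\<lambda>_. 0)
    (\<lambda>x. \<Sum>i\<in>UNIV. \<Sum>j\<in>UNIV. M $ i $ j * V i j x) H"
proof -
  obtain H where H: "dirichlet_solution (ball 0 R) A (\<lambda>x. A x $ i $ j) (\<lambda>_. 0) (V i j) (H i j)" for i j
    using V unfolding solves_in_ball_def by metis
  have "dirichlet_solution (ball 0 R) A (\<lambda>x. \<Sum>i\<in>UNIV. \<Sum>j\<in>UNIV. M $ i $ j * A x $ i $ j)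
    (\<lambda>x. \<Sum>i\<in>(UNIV::'n set). \<Sum>j\<in>(UNIV::'n set). M $ i $ j * 0)
    (\<lambda>x. \<Sum>i\<in>UNIV. \<Sum>j\<in>UNIV. M $ i $ j * V i j x)
    (\<lambda>x. \<Sum>i\<in>UNIV. \<Sum>j\<in>UNIV. (M $ i $ j) *\<^sub>R H i j x)"
    by (intro dirichlet_solution_sum dirichlet_solution_scale H)
  then show ?thesis
    by (auto simp: inner_vec_def mult.commute)
qed

lemma combination_center:
  "(\<Sum>i\<in>UNIV. \<Sum>j\<in>UNIV. M $ i $ j * V i j 0) = T 0 * (A_hat T V \<bullet> M)"
  using T_center_pos by (simp add: A_hat_def inner_vec_def sum_distrib_left mult.commute)

text \<open>Comparison of \<open>c T\<close> with the solution for data \<open>A : M\<close>,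
  evaluated at the centre and divided by \<open>T 0 > 0\<close>. Every Loewner bound on the
  estimator is an instance of this lemma or its mirror image.\<close>

lemma A_hat_ge:
  assumes "\<And>x. x \<in> ball 0 R \<Longrightarrow> c \<le> A x \<bullet> M"
  shows "c \<le> A_hat T V \<bullet> M"
proof -
  obtain H K where H: "dirichlet_solution (ball 0 R) A (\<lambda>_. 1) (\<lambda>_. 0) T H"
    and K: "dirichlet_solution (ball 0 R) A (\<lambda>x. A x \<bullet> M) (\<lambda>_. 0)
      (\<lambda>x. \<Sum>i\<in>UNIV. \<Sum>j\<in>UNIV. M $ i $ j * V i j x) K"
    using T_solution combination_solution by blast
  have "c * T 0 \<le> (\<Sum>i\<in>UNIV. \<Sum>j\<in>UNIV. M $ i $ j * V i j 0)"
    by (rule dirichlet_comparison[OF _ _ sym pos dirichlet_solution_scale[OF H, of c] K])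
       (use assms R in auto)
  then show ?thesis
    using T_center_pos
    by (simp only: combination_center mult.commute[of c] mult_le_cancel_left_pos)
qed

lemma A_hat_le:
  assumes "\<And>x. x \<in> ball 0 R \<Longrightarrow> A x \<bullet> M \<le> c"
  shows "A_hat T V \<bullet> M \<le> c"
  using A_hat_ge[of "- c" "- M"] assms by simp

text \<open>By symmetry of \<open>A\<close>, \<open>V i j\<close> and \<open>V j i\<close> solve the
  same problem.\<close>

lemma sym_A_hat: "sym_matrix (A_hat T V)"
proof -
  have "V i j 0 = V j i 0" for i j
  proof (rule solves_in_ball_unique[OF R sym pos V[of i j]])
    show "solves_in_ball R A (\<lambda>x. A x $ i $ j) (V j i)"
      using V[of j i] by (simp add: sym_matrix_component[OF sym, of _ i j])
  qed (use R in auto)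
  then show ?thesis
    by (simp add: sym_matrix_def transpose_def A_hat_def vec_eq_iff)
qed

lemma kappa_le_A_hat:
  assumes "continuous_on UNIV A"
  shows "loewner_le (kappa R A *\<^sub>R mat 1) (A_hat T V)"
  unfolding loewner_le_def
proof
  fix v :: "real^'n"
  have "kappa R A * (v \<bullet> v) \<le> A_hat T V \<bullet> outer v"
  proof (rule A_hat_ge)
    fix x :: "real^'n" assume "x \<in> ball 0 R"
    then have "kappa R A \<le> lambda_min (A x)"
      using kappa_attained(2)[OF assms sym, of R x] R by auto
    then have "kappa R A * (v \<bullet> v) \<le> lambda_min (A x) * (v \<bullet> v)"
      by (intro mult_right_mono) auto
    also have "\<dots> \<le> A x \<bullet> outer v"
      unfolding inner_outer by (rule lambda_min_Rayleigh(2)[OF sym])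
    finally show "kappa R A * (v \<bullet> v) \<le> A x \<bullet> outer v" .
  qed
  then show "v \<bullet> (kappa R A *\<^sub>R mat 1 *v v) \<le> v \<bullet> (A_hat T V *v v)"
    by (simp add: inner_outer scaleR_matrix_vector_assoc[symmetric])
qed

lemma A_hat_le_id: "loewner_le (A_hat T V) (mat 1)"
  unfolding loewner_le_def
proof
  fix v :: "real^'n"
  have "A_hat T V \<bullet> outer v \<le> v \<bullet> (mat 1 *v v)"
    using le_id unfolding loewner_le_def by (intro A_hat_le) (simp add: inner_outer)
  then show "v \<bullet> (A_hat T V *v v) \<le> v \<bullet> (mat 1 *v v)"
    by (simp only: inner_outer)
qed

lemma error_center:
  assumes "solves_in_ball R A (\<lambda>x. (A x - N) \<bullet> M) w"
  shows "w 0 = T 0 * ((A_hat T V - N) \<bullet> M)"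
proof -
  let ?u = "\<lambda>x. (\<Sum>i\<in>UNIV. \<Sum>j\<in>UNIV. M $ i $ j * V i j x) + - (N \<bullet> M) * T x"
  obtain H K L where H: "dirichlet_solution (ball 0 R) A (\<lambda>_. 1) (\<lambda>_. 0) T H"
    and K: "dirichlet_solution (ball 0 R) A (\<lambda>x. A x \<bullet> M) (\<lambda>_. 0)
      (\<lambda>x. \<Sum>i\<in>UNIV. \<Sum>j\<in>UNIV. M $ i $ j * V i j x) K"
    and L: "dirichlet_solution (ball 0 R) A (\<lambda>x. (A x - N) \<bullet> M) (\<lambda>_. 0) w L"
    using T_solution combination_solution assms unfolding solves_in_ball_def by blast
  have u: "dirichlet_solution (ball 0 R) A (\<lambda>x. (A x - N) \<bullet> M) (\<lambda>_. 0) ?u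
      (\<lambda>x. K x + - (N \<bullet> M) *\<^sub>R H x)"
    using dirichlet_solution_add[OF K dirichlet_solution_scale[OF H, of "- (N \<bullet> M)"]]
    by (simp add: inner_diff_left)
  have "0 \<in> closure (ball (0::real^'n) R)" using R by simp
  \<comment> \<open>Two-sided comparison is used because \<open>?u\<close> is available only as a
    classical solution, without a Hoelder bound on its Hessian.\<close>
  then have "w 0 = ?u 0"
    by (intro order_antisym dirichlet_comparison[OF _ _ sym pos L u]
        dirichlet_comparison[OF _ _ sym pos u L]) auto
  then show ?thesis
    by (simp add: combination_center inner_diff_left right_diff_distrib)
qed

lemma A_hat_error:
  assumes "sym_matrix N"
  obtains M where "sym_matrix M" "norm M \<le> 1"
    and "\<And>w. solves_in_ball R A (\<lambda>x. (A x - N) \<bullet> M) w \<Longrightarrow>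
      norm (A_hat T V - N) \<le> 2 * real CARD('n) * (\<bar>w 0\<bar> / R\<^sup>2)"
proof
  let ?D = "A_hat T V - N"
  \<comment> \<open>If the error vanishes, division by zero gives \<open>?M = 0\<close>, and all the
    claims remain true.\<close>
  let ?M = "(1 / norm ?D) *\<^sub>R ?D"
  show "sym_matrix ?M"
    by (intro sym_matrix_scaleR sym_matrix_diff sym_A_hat assms)
  show "norm ?M \<le> 1" by simp
  fix w assume w: "solves_in_ball R A (\<lambda>x. (A x - N) \<bullet> ?M) w"
  have "?D \<bullet> ?M = norm ?D"
    by (simp add: dot_square_norm power2_eq_square)
  then have "w 0 = T 0 * norm ?D"
    using error_center[OF w] by simp
  moreover have "R\<^sup>2 / (2 * real CARD('n)) * norm ?D \<le> T 0 * norm ?D"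
    by (intro mult_right_mono T_center_ge) simp
  ultimately have "R\<^sup>2 / (2 * real CARD('n)) * norm ?D \<le> \<bar>w 0\<bar>"
    by linarith
  then show "norm ?D \<le> 2 * real CARD('n) * (\<bar>w 0\<bar> / R\<^sup>2)"
    using R by (simp add: field_simps)
qed

end

section \<open>From the essential supremum to the value at the centre\<close>

text \<open>Otherwise \<open>f\<close> would exceed the essential supremum on a nonempty open set,
  which is not null. This links \<open>X_err\<close> to the central value that controls the
  error.\<close>

lemma esssup_ge_continuous:
  fixes f :: "'a::euclidean_space \<Rightarrow> real"
  assumes U: "open U" "x \<in> U" and f: "continuous_on U f"
  shows "ereal (f x) \<le> esssup (lebesgue_on U) (\<lambda>y. ereal (f y))"
proof (rule ccontr)
  let ?s = "esssup (lebesgue_on U) (\<lambda>y. ereal (f y))"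
  assume "\<not> ereal (f x) \<le> ?s"
  then have less: "?s < ereal (f x)" by simp
  then obtain c where c: "?s < ereal c" "c < f x"
    using ereal_dense2 by (metis ereal_less_eq(3) less_ereal.simps(1) not_le)
  let ?W = "U \<inter> f -` {c<..}"
  have W: "open ?W" "?W \<noteq> {}"
    using continuous_open_preimage[OF f U(1), of "{c<..}"] U(2) c(2) by auto
  have "AE y in lebesgue_on U. ereal (f y) \<le> ?s"
    by (rule esssup_AE)
  then have "AE y in lebesgue. y \<in> U \<longrightarrow> ereal (f y) \<le> ?s"
    using U(1) by (subst (asm) AE_restrict_space_iff) auto
  then have "AE y in lebesgue. y \<notin> ?W"
    by (rule AE_mp) (use c(1) in \<open>auto intro!: AE_I2 dest: le_less_trans\<close>)
  then have "negligible ?W"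
    using W(1) by (simp add: negligible_iff_null_sets AE_iff_null_sets)
  then show False
    using open_not_negligible[OF W] by contradiction
qed

section \<open>Stability in the coefficients and measurability\<close>

text \<open>Seen as solutions for \<open>B\<close>, \<open>u\<close> acquires an error of at most
  \<open>\<eta> * C\<close> in its right-hand side, while that of \<open>S\<close> stays at least
  \<open>1 / 2\<close>. A multiple of \<open>S\<close> is thus a barrier for \<open>v - u\<close> on
  both sides.\<close>

lemma dirichlet_solution_stability:
  assumes U: "open U" "bounded U"
    and B: "\<And>x. x \<in> U \<Longrightarrow> sym_matrix (B x)" "\<And>x. x \<in> U \<Longrightarrow> pos_def (B x)"
    and u: "dirichlet_solution U A f h u H"
    and S: "dirichlet_solution U A (\<lambda>_. 1) (\<lambda>_. 0) S L"
    and v: "dirichlet_solution U B g h v K"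
    and H: "\<And>x. x \<in> U \<Longrightarrow> norm (H x) \<le> C"
    and L: "\<And>x. x \<in> U \<Longrightarrow> norm (L x) \<le> C"
    and AB: "\<And>x. x \<in> U \<Longrightarrow> norm (A x - B x) \<le> \<eta>"
    and fg: "\<And>x. x \<in> U \<Longrightarrow> \<bar>f x - g x\<bar> \<le> \<eta>"
    and \<eta>: "0 \<le> \<eta>" "0 \<le> C" "\<eta> * C \<le> 1 / 2"
    and x: "x \<in> closure U"
  shows "\<bar>v x - u x\<bar> \<le> 2 * \<eta> * (1 + C) * S x"
proof -
  \<comment> \<open>Half of \<open>c\<close> equals \<open>\<eta> + \<eta> * C\<close>, the sum of
    the perturbations of the data and of the operator.\<close>
  define c where "c = 2 * \<eta> * (1 + C)"
  have c: "0 \<le> c" using \<eta> by (simp add: c_def)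
  have pert: "\<bar>(A y - B y) \<bullet> N\<bar> \<le> \<eta> * C" if "y \<in> U" "norm N \<le> C" for y N
    by (rule order_trans[OF Cauchy_Schwarz_ineq2 mult_mono[OF AB[OF that(1)] that(2) \<eta>(1)]]) simp
  note uB = dirichlet_solution_change_operator[OF u, of B]
  note SB = dirichlet_solution_scale[OF dirichlet_solution_change_operator[OF S, of B], of c]
  have S_low: "\<eta> + \<eta> * C \<le> c * (1 + (A y - B y) \<bullet> L y)" if y: "y \<in> U" for y
  proof -
    have "1 / 2 \<le> 1 + (A y - B y) \<bullet> L y"
      using pert[OF y L[OF y]] \<eta>(3) by linarith
    then have "c * (1 / 2) \<le> c * (1 + (A y - B y) \<bullet> L y)"
      using c by (rule mult_left_mono)
    then show ?thesis by (simp add: c_def algebra_simps)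
  qed
  have "u x \<le> v x + c * S x"
  proof (rule dirichlet_comparison[OF U B uB dirichlet_solution_add[OF v SB]])
    show "f y + (A y - B y) \<bullet> H y \<le> g y + c * (1 + (A y - B y) \<bullet> L y)" if "y \<in> U" for y
      using pert[OF that H[OF that]] S_low[OF that] fg[OF that] by linarith
  qed (use x in auto)
  moreover have "v x \<le> u x + c * S x"
  proof (rule dirichlet_comparison[OF U B v dirichlet_solution_add[OF uB SB]])
    show "g y \<le> f y + (A y - B y) \<bullet> H y + c * (1 + (A y - B y) \<bullet> L y)" if "y \<in> U" for y
      using pert[OF that H[OF that]] S_low[OF that] fg[OF that] by linarith
  qed (use x in auto)
  ultimately show ?thesis
    unfolding c_def by linarith
qed

text \<open>The Hessian bounds concern only the solutions \<open>u\<close> and \<open>S\<close> for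
  \<open>A\<close>, so \<open>d\<close> can be fixed before \<open>B\<close>, \<open>g\<close> and
  \<open>v\<close>.\<close>

lemma center_value_continuous:
  fixes A :: "'n::finite matrix_field"
  assumes R: "0 < R" and e: "0 < e"
    and u: "solves_in_ball R A f u" and S: "solves_in_ball R A (\<lambda>_. 1) S"
  obtains d where "0 < d"
    "\<And>B g v. \<lbrakk>\<And>x. sym_matrix (B x); \<And>x. pos_def (B x); solves_in_ball R B g v;
       \<And>x. x \<in> cball 0 R \<Longrightarrow> dist (B x) (A x) < d;
       \<And>x. x \<in> cball 0 R \<Longrightarrow> \<bar>f x - g x\<bar> \<le> norm (A x - B x)\<rbrakk> \<Longrightarrow> dist (v 0) (u 0) < e"
proof -
  obtain H C1 where H: "dirichlet_solution (ball 0 R) A f (\<lambda>_. 0) u H"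
    and C1: "\<And>x. x \<in> ball 0 R \<Longrightarrow> norm (H x) \<le> C1"
    using solves_in_ball_bounded_hessian[OF u] by blast
  obtain L C2 where L: "dirichlet_solution (ball 0 R) A (\<lambda>_. 1) (\<lambda>_. 0) S L"
    and C2: "0 \<le> C2" "\<And>x. x \<in> ball 0 R \<Longrightarrow> norm (L x) \<le> C2"
    using solves_in_ball_bounded_hessian[OF S] by blast
  define C where "C = max C1 C2"
  have C: "0 \<le> C" using C2(1) by (simp add: C_def)
  define q where "q = \<bar>S 0\<bar>"
  \<comment> \<open>The first term secures \<open>d * C \<le> 1 / 2\<close> for stability, the
    second makes the barrier smaller than \<open>e\<close> at the centre; the added ones keep the
    denominators positive.\<close>
  define d where "d = min (1 / (2 * (C + 1))) (e / (2 * (1 + C) * (q + 1)))"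
  have q: "0 \<le> q" by (simp add: q_def)
  have d: "0 < d" using C e q by (simp add: d_def)
  have dC: "d * C \<le> 1 / 2"
  proof -
    have "d * C \<le> 1 / (2 * (C + 1)) * C"
      using C by (intro mult_right_mono) (auto simp: d_def)
    also have "\<dots> \<le> 1 / 2"
      using C by (simp add: divide_simps)
    finally show ?thesis .
  qed
  have dS: "2 * d * (1 + C) * S 0 < e"
  proof -
    have "2 * d * (1 + C) * S 0 \<le> 2 * d * (1 + C) * q"
      using d C by (intro mult_left_mono) (auto simp: q_def)
    also have "\<dots> \<le> 2 * (e / (2 * (1 + C) * (q + 1))) * (1 + C) * q"
      using C q by (intro mult_right_mono mult_left_mono) (auto simp: d_def)
    also have "\<dots> = e * q / (q + 1)"
      using C q by (simp add: divide_simps)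
    also have "\<dots> < e"
      using e q by (simp add: divide_less_eq algebra_simps)
    finally show ?thesis .
  qed
  show thesis
  proof (rule that[OF d])
    fix B :: "'n matrix_field" and g v
    assume B: "\<And>x. sym_matrix (B x)" "\<And>x. pos_def (B x)" and v: "solves_in_ball R B g v"
      and close: "\<And>x. x \<in> cball 0 R \<Longrightarrow> dist (B x) (A x) < d"
      and fg: "\<And>x. x \<in> cball 0 R \<Longrightarrow> \<bar>f x - g x\<bar> \<le> norm (A x - B x)"
    obtain K where K: "dirichlet_solution (ball 0 R) B g (\<lambda>_. 0) v K"
      using v unfolding solves_in_ball_def by blast
    have AB: "norm (A x - B x) \<le> d" if "x \<in> ball 0 R" for x
      using close[of x] that by (auto simp: dist_norm norm_minus_commute)
    have "\<bar>f x - g x\<bar> \<le> d" if "x \<in> ball 0 R" for x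
      using fg[of x] AB[OF that] that by auto
    then have "\<bar>v 0 - u 0\<bar> \<le> 2 * d * (1 + C) * S 0"
      using C1 C2(2) AB d C dC R
      by (intro dirichlet_solution_stability[OF _ _ B H L K]) (fastforce simp: C_def)+
    then show "dist (v 0) (u 0) < e"
      using dS by (simp add: dist_real_def)
  qed
qed

text \<open>Continuity on \<open>\<Omega>\<close> for uniform distance on one compact set makes each
  preimage of an open set the trace on \<open>\<Omega>\<close> of a locally uniformly open
  set.\<close>

lemma locally_uniform_measurable:
  fixes P :: "'n::finite matrix_field measure" and F :: "'n matrix_field \<Rightarrow> 'b::metric_space"
  assumes law: "field_law P" and \<Omega>: "\<Omega> \<in> sets P" and K: "compact K"
    and cont: "\<And>A e. A \<in> \<Omega> \<Longrightarrow> 0 < e \<Longrightarrow>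
      \<exists>d>0. \<forall>B\<in>\<Omega>. (\<forall>x\<in>K. dist (B x) (A x) < d) \<longrightarrow> dist (F B) (F A) < e"
  shows "F \<in> borel_measurable (restrict_space P \<Omega>)"
proof (rule borel_measurableI)
  fix S :: "'b set" assume S: "open S"
  have space: "space P = continuous_fields"
    and sets: "sets P = sigma_sets continuous_fields {\<U>. openin locally_uniform_topology \<U>}"
    using law by (auto simp: field_law_def)
  have \<Omega>_sub: "\<Omega> \<subseteq> continuous_fields"
    using sets.sets_into_space[OF \<Omega>] space by simp
  \<comment> \<open>Only \<open>B\<close> is restricted to \<open>\<Omega>\<close>; the centre
    \<open>A\<close> may be any continuous field, so that \<open>\<U>\<close> is open in the whole
    canonical space.\<close>
  define Q where "Q A d \<longleftrightarrow> (\<forall>B\<in>\<Omega>. (\<forall>x\<in>K. dist (B x) (A x) < d) \<longrightarrow> F B \<in> S)" for A d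
  define \<U> where "\<U> = {A \<in> continuous_fields. \<exists>d>0. Q A d}"
  have "openin locally_uniform_topology \<U>"
    unfolding openin_locally_uniform_topology
  proof (intro conjI ballI)
    show "\<U> \<subseteq> continuous_fields" by (auto simp: \<U>_def)
    fix A assume "A \<in> \<U>"
    then obtain d where d: "0 < d" "Q A d" by (auto simp: \<U>_def)
    have "A' \<in> \<U>" if A': "A' \<in> continuous_fields" "\<forall>x\<in>K. dist (A' x) (A x) < d / 2" for A'
    proof -
      have "Q A' (d / 2)"
        unfolding Q_def
      proof (intro ballI impI)
        fix B assume B: "B \<in> \<Omega>" "\<forall>x\<in>K. dist (B x) (A' x) < d / 2"
        then have "\<forall>x\<in>K. dist (B x) (A x) < d"
          using A'(2) by (metis dist_commute dist_triangle_half_l)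
        then show "F B \<in> S" using d(2) B(1) by (auto simp: Q_def)
      qed
      then show ?thesis
        unfolding \<U>_def using A'(1) d(1) by (auto intro!: exI[of _ "d / 2"])
    qed
    then show "\<exists>K e. compact K \<and> 0 < e \<and>
        {B \<in> continuous_fields. \<forall>x\<in>K. dist (B x) (A x) < e} \<subseteq> \<U>"
      using K d(1) by (intro exI[of _ K] exI[of _ "d / 2"]) auto
  qed
  then have "\<U> \<in> sets P"
    unfolding sets by (intro sigma_sets.Basic) simp
  moreover have "F -` S \<inter> space (restrict_space P \<Omega>) = \<U> \<inter> \<Omega>"
  proof -
    have "A \<in> \<U>" if A: "A \<in> \<Omega>" "F A \<in> S" for A
    proof -
      obtain e where e: "0 < e" "\<And>y. dist y (F A) < e \<Longrightarrow> y \<in> S"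
        using S A(2) unfolding open_dist by blast
      obtain d where "0 < d" "\<forall>B\<in>\<Omega>. (\<forall>x\<in>K. dist (B x) (A x) < d) \<longrightarrow> dist (F B) (F A) < e"
        using cont[OF A(1) e(1)] by blast
      then show ?thesis
        unfolding \<U>_def Q_def using A(1) \<Omega>_sub e(2) by blast
    qed
    moreover have "F A \<in> S" if "A \<in> \<U>" "A \<in> \<Omega>" for A
      using that unfolding \<U>_def Q_def by auto
    ultimately show ?thesis
      using \<Omega>_sub by (auto simp: space_restrict_space space)
  qed
  ultimately show "F -` S \<inter> space (restrict_space P \<Omega>) \<in> sets (restrict_space P \<Omega>)"
    using \<Omega> by (auto simp: sets_restrict_space Int_commute)
qed

section \<open>Passage from single realizations to the probability space\<close>

theorem proposition8p8:
  fixes P :: "'n::finite matrix_field measure"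
    and Abar :: "real^'n^'n"
    and T :: "real \<Rightarrow> 'n matrix_field \<Rightarrow> real^'n \<Rightarrow> real"
    and V :: "real \<Rightarrow> 'n matrix_field \<Rightarrow> 'n \<Rightarrow> 'n \<Rightarrow> real^'n \<Rightarrow> real"
    and w :: "real \<Rightarrow> 'n matrix_field \<Rightarrow> real^'n^'n \<Rightarrow> real^'n \<Rightarrow> real"
  assumes dim: "2 \<le> CARD('n)"
    and law: "field_law P"
    and H: "H1 P" "H2 P" "H3 P" "H4 P" "H5 P"
    and Abar: "effective_matrix P Abar"
    and T: "AE A in P. \<forall>R>0. solves_in_ball R A (\<lambda>_. 1) (T R A)"
    and V: "AE A in P. \<forall>R>0. \<forall>i j. solves_in_ball R A (\<lambda>x. A x $ i $ j) (V R A i j)"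
    and w: "AE A in P. \<forall>R>0. \<forall>M. sym_matrix M \<longrightarrow>
              solves_in_ball R A (\<lambda>x. (A x - Abar) \<bullet> M) (w R A M)"
  shows "\<exists>\<Omega>\<^sub>0\<in>sets P. measure P \<Omega>\<^sub>0 = 1 \<and>
     (\<forall>A\<in>\<Omega>\<^sub>0. \<forall>R>0.
        0 < kappa R A \<and>
        (\<forall>f u v. solves_in_ball R A f u \<and> solves_in_ball R A f v \<longrightarrow> (\<forall>x\<in>cball 0 R. u x = v x)) \<and>
        T R A 0 \<noteq> 0 \<and>
        sym_matrix (A_hat (T R A) (V R A)) \<and>
        loewner_le (kappa R A *\<^sub>R mat 1) (A_hat (T R A) (V R A)) \<and>
        loewner_le (A_hat (T R A) (V R A)) (mat 1) \<and>
        ereal (norm (A_hat (T R A) (V R A) - Abar)) \<le> ereal (2 * real CARD('n)) * X_err R (w R A)) \<and>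
     (\<forall>R>0. (\<lambda>A. A_hat (T R A) (V R A)) \<in> borel_measurable (restrict_space P \<Omega>\<^sub>0))"
proof -
  interpret prob_space P using law by (simp add: field_law_def)
  \<comment> \<open>All radii are covered at once, so that one event serves every
    \<open>R\<close>.\<close>
  define good where "good A \<longleftrightarrow>
      (\<forall>x. sym_matrix (A x) \<and> pos_def (A x) \<and> loewner_le (A x) (mat 1)) \<and>
      (\<forall>R>0. solves_in_ball R A (\<lambda>_. 1) (T R A)) \<and>
      (\<forall>R>0. \<forall>i j. solves_in_ball R A (\<lambda>x. A x $ i $ j) (V R A i j)) \<and>
      (\<forall>R>0. \<forall>M. sym_matrix M \<longrightarrow> solves_in_ball R A (\<lambda>x. (A x - Abar) \<bullet> M) (w R A M))" for A
  have "AE A in P. good A"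
    using H(1) T V w unfolding H1_def good_def by eventually_elim blast
  \<comment> \<open>The set where \<open>good\<close> fails is only known to lie in a measurable
    null set; removing that set yields a measurable event.\<close>
  then obtain N where N: "{A \<in> space P. \<not> good A} \<subseteq> N" "emeasure P N = 0" "N \<in> sets P"
    by (rule AE_E)
  define \<Omega> where "\<Omega> = space P - N"
  have \<Omega>: "\<Omega> \<in> sets P" using N(3) by (auto simp: \<Omega>_def)
  have prob\<Omega>: "prob \<Omega> = 1"
    unfolding \<Omega>_def using prob_compl[OF N(3)] N(2) by (simp add: measure_def)
  have good: "good A" "continuous_on UNIV A" if "A \<in> \<Omega>" for A
    using that N(1) law by (auto simp: \<Omega>_def field_law_def continuous_fields_def)
  have estimator: "ball_estimator A R (T R A) (V R A)" if "A \<in> \<Omega>" "0 < R" for A R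
    using good(1)[OF that(1)] that(2) by unfold_locales (auto simp: good_def)
  have error: "ereal (norm (A_hat (T R A) (V R A) - Abar))
      \<le> ereal (2 * real CARD('n)) * X_err R (w R A)" if A: "A \<in> \<Omega>" and R: "0 < R" for A R
  proof -
    interpret ball_estimator A R "T R A" "V R A" by (rule estimator[OF A R])
    have "sym_matrix Abar" using Abar by (simp add: effective_matrix_def)
    then obtain M where M: "sym_matrix M" "norm M \<le> 1"
      and err: "\<And>w. solves_in_ball R A (\<lambda>x. (A x - Abar) \<bullet> M) w \<Longrightarrow>
        norm (A_hat (T R A) (V R A) - Abar) \<le> 2 * real CARD('n) * (\<bar>w 0\<bar> / R\<^sup>2)"
      using A_hat_error by blast
    have wM: "solves_in_ball R A (\<lambda>x. (A x - Abar) \<bullet> M) (w R A M)"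
      using good(1)[OF A] R M(1) by (simp add: good_def)
    then have "continuous_on (ball 0 R) (w R A M)"
      unfolding solves_in_ball_def dirichlet_solution_def
      by (metis closure_subset continuous_on_subset)
    then have "ereal \<bar>w R A M 0\<bar> \<le> esssup (lebesgue_on (ball 0 R)) (\<lambda>x. ereal \<bar>w R A M x\<bar>)"
      using R by (intro esssup_ge_continuous continuous_intros) auto
    also have "\<dots> \<le> (SUP M\<in>{M. sym_matrix M \<and> norm M \<le> 1}.
        esssup (lebesgue_on (ball 0 R)) (\<lambda>x. ereal \<bar>w R A M x\<bar>))"
      using M by (intro SUP_upper) simp
    finally have "ereal (1 / R\<^sup>2) * ereal \<bar>w R A M 0\<bar> \<le> X_err R (w R A)"
      unfolding X_err_def by (rule ereal_mult_left_mono) simp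
    then have "ereal (2 * real CARD('n)) * (ereal (1 / R\<^sup>2) * ereal \<bar>w R A M 0\<bar>)
        \<le> ereal (2 * real CARD('n)) * X_err R (w R A)"
      by (rule ereal_mult_left_mono) simp
    moreover have "ereal (norm (A_hat (T R A) (V R A) - Abar))
        \<le> ereal (2 * real CARD('n)) * (ereal (1 / R\<^sup>2) * ereal \<bar>w R A M 0\<bar>)"
      using err[OF wM] by simp
    ultimately show ?thesis by (rule order_trans[rotated])
  qed
  have meas: "(\<lambda>A. A_hat (T R A) (V R A)) \<in> borel_measurable (restrict_space P \<Omega>)" if R: "0 < R" for R
  proof -
    \<comment> \<open>The pointwise Lipschitz condition on the data covers both the constant
      \<open>1\<close> of \<open>T\<close> and the entries of \<open>A\<close> for
      \<open>V\<close>.\<close>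
    have center: "(\<lambda>A. u A 0) \<in> borel_measurable (restrict_space P \<Omega>)"
      if u: "\<And>A. A \<in> \<Omega> \<Longrightarrow> solves_in_ball R A (f A) (u A)"
        and f: "\<And>A B x. \<bar>f A x - f B x\<bar> \<le> norm (A x - B x)"
      for f u :: "'n matrix_field \<Rightarrow> real^'n \<Rightarrow> real"
    proof (rule locally_uniform_measurable[OF law \<Omega> compact_cball])
      fix A and e :: real assume A: "A \<in> \<Omega>" and e: "0 < e"
      have S: "solves_in_ball R A (\<lambda>_. 1) (T R A)"
        using good(1)[OF A] R by (simp add: good_def)
      obtain d where d: "0 < d"
        "\<And>B g v. \<lbrakk>\<And>x. sym_matrix (B x); \<And>x. pos_def (B x); solves_in_ball R B g v;
          \<And>x. x \<in> cball 0 R \<Longrightarrow> dist (B x) (A x) < d;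
          \<And>x. x \<in> cball 0 R \<Longrightarrow> \<bar>f A x - g x\<bar> \<le> norm (A x - B x)\<rbrakk> \<Longrightarrow> dist (v 0) (u A 0) < e"
        using center_value_continuous[OF R e u[OF A] S] by blast
      show "\<exists>d>0. \<forall>B\<in>\<Omega>. (\<forall>x\<in>cball 0 R. dist (B x) (A x) < d) \<longrightarrow> dist (u B 0) (u A 0) < e"
      proof (intro exI conjI ballI impI)
        fix B assume B: "B \<in> \<Omega>" "\<forall>x\<in>cball 0 R. dist (B x) (A x) < d"
        show "dist (u B 0) (u A 0) < e"
          using good(1)[OF B(1)] B(2) f by (intro d(2)[OF _ _ u[OF B(1)]]) (auto simp: good_def)
      qed (rule d(1))
    qed
    have T_meas: "(\<lambda>A. T R A 0) \<in> borel_measurable (restrict_space P \<Omega>)"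
    proof (rule center[of "\<lambda>_ _. 1" "T R"])
      show "solves_in_ball R A (\<lambda>_. 1) (T R A)" if "A \<in> \<Omega>" for A
        using good(1)[OF that] R by (simp add: good_def)
    qed simp
    have V_meas: "(\<lambda>A. V R A i j 0) \<in> borel_measurable (restrict_space P \<Omega>)" for i j
    proof (rule center[of "\<lambda>A x. A x $ i $ j" "\<lambda>A. V R A i j"])
      show "solves_in_ball R A (\<lambda>x. A x $ i $ j) (V R A i j)" if "A \<in> \<Omega>" for A
        using good(1)[OF that] R by (simp add: good_def)
      show "\<bar>A x $ i $ j - B x $ i $ j\<bar> \<le> norm (A x - B x)" for A B :: "'n matrix_field" and x
        using component_le_norm_cart[of "(A x - B x) $ i" j] Finite_Cartesian_Product.norm_nth_le[of "A x - B x" i] by simp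
    qed
    show ?thesis
    proof (rule borel_measurable_euclidean_space[THEN iffD2], rule ballI)
      fix b :: "real^'n^'n" assume "b \<in> Basis"
      then obtain i j where b: "b = axis i (axis j 1)"
        by (auto simp: Basis_vec_def)
      show "(\<lambda>A. A_hat (T R A) (V R A) \<bullet> b) \<in> borel_measurable (restrict_space P \<Omega>)"
        unfolding b inner_axis A_hat_def using T_meas V_meas[of i j] by simp
    qed
  qed
  show ?thesis
  proof (intro bexI[of _ \<Omega>] conjI ballI allI impI \<Omega> prob\<Omega> meas error)
    fix A and R :: real assume A: "A \<in> \<Omega>" and R: "0 < R"
    interpret ball_estimator A R "T R A" "V R A" by (rule estimator[OF A R])
    show "0 < kappa R A"
      using kappa_pos[OF good(2)[OF A] sym pos] R by simp
    show "T R A 0 \<noteq> 0" using T_center_pos by simp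
    show "sym_matrix (A_hat (T R A) (V R A))" by (rule sym_A_hat)
    show "loewner_le (kappa R A *\<^sub>R mat 1) (A_hat (T R A) (V R A))"
      by (rule kappa_le_A_hat[OF good(2)[OF A]])
    show "loewner_le (A_hat (T R A) (V R A)) (mat 1)" by (rule A_hat_le_id)
    show "u x = v x" if "solves_in_ball R A f u \<and> solves_in_ball R A f v" "x \<in> cball 0 R" for f u v x
      using solves_in_ball_unique[where A = A, OF R sym pos] that by blast
  qed
qed

end
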